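(* Let $G=(V,E)$ be a finite simple undirected graph and $\{x,y\}\in E$. Let $G_{x,y}$ be the graph obtained by subdividing $\{x,y\}$. Then \[\operatorname{nlcw}(G)-2\le\operatorname{nlcw}(G_{x,y})\le\operatorname{nlcw}(G)+2\quad\text{and}\quad \operatorname{cw}(G)-2\le\operatorname{cw}(G_{x,y})\le\operatorname{cw}(G)+2.\]
   Context: Subdivision: $G_{x,y}$ has vertex set $V\cup\{z\}$ for a new vertex $z$ and edge set $(E\setminus\{\{x,y\}\})\cup\{\{x,z\},\{y,z\}\}$. Clique-width: for a positive integer $k$, $\mathrm{CW}_k$ is the smallest class of graphs whose vertices carry labels from $\{1,\dots,k\}$ that contains every single-vertex graph with any label and is closed under: disjoint union; relabeling $\rho_{a\to b}$ for $a\neq b$; and $\eta_{a,b}$ for $a\neq b$ (add all edges between vertices labeled $a$ and vertices labeled $b$). $\operatorname{cw}(G)$ is the least $k$ such that some labeling of $G$ lies in $\mathrm{CW}_k$. NLC-width: $\mathrm{NLC}_k$ is the smallest class of labeled graphs (labels in $\{1,\dots,k\}$) containing every single-vertex graph with any label and closed under: $G\times_S J$ for $S\subseteq\{1,\dots,k\}^2$ (disjoint union of vertex-disjoint $G$ and $J$ plus all edges $\{u,v\}$, $u\in V_G$, $v\in V_J$, $(\mathrm{lab}(u),\mathrm{lab}(v))\in S$); and $\circ_R$ for $R:\{1,\dots,k\}\to\{1,\dots,k\}$. $\operatorname{nlcw}(G)$ is the least $k$ such that some labeling of $G$ lies in $\mathrm{NLC}_k$. *)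

theory Defs
  imports Main "HOL-Library.FuncSet"
begin

definition finite_simple_graph :: "'a set \<Rightarrow> 'a set set \<Rightarrow> bool" where
  "finite_simple_graph V E \<longleftrightarrow>
     finite V \<and> (\<forall>e\<in>E. \<exists>u\<in>V. \<exists>v\<in>V. u \<noteq> v \<and> e = {u, v})"

definition subdivide_verts :: "'a set \<Rightarrow> 'a \<Rightarrow> 'a set" where
  "subdivide_verts V z = V \<union> {z}"

definition subdivide_edges :: "'a set set \<Rightarrow> 'a \<Rightarrow> 'a \<Rightarrow> 'a \<Rightarrow> 'a set set" where
  "subdivide_edges E x y z = (E - {{x, y}}) \<union> {{x, z}, {y, z}}"

text \<open>
  A labeled graph is a triple \<open>(V, E, lab)\<close>. The labeling is a total function of which only
  the values on \<open>V\<close> are meaningful: no rule below constrains or inspects the values of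
  \<open>lab\<close> outside \<open>V\<close>.
\<close>

type_synonym 'a labeled_graph = "'a set \<times> 'a set set \<times> ('a \<Rightarrow> nat)"

inductive_set CW :: "nat \<Rightarrow> 'a labeled_graph set" for k :: nat where
  single: "lab v \<in> {1..k} \<Longrightarrow> ({v}, {}, lab) \<in> CW k"
| disjoint_union:
    "\<lbrakk>(V, E, lab) \<in> CW k; (V', E', lab') \<in> CW k; V \<inter> V' = {}\<rbrakk>
     \<Longrightarrow> (V \<union> V', E \<union> E', \<lambda>v. if v \<in> V then lab v else lab' v) \<in> CW k"
| relabel:
    "\<lbrakk>(V, E, lab) \<in> CW k; a \<in> {1..k}; b \<in> {1..k}; a \<noteq> b\<rbrakk>
     \<Longrightarrow> (V, E, \<lambda>v. if lab v = a then b else lab v) \<in> CW k"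
| add_edges:
    "\<lbrakk>(V, E, lab) \<in> CW k; a \<in> {1..k}; b \<in> {1..k}; a \<noteq> b\<rbrakk>
     \<Longrightarrow> (V, E \<union> {{u, v} | u v. u \<in> V \<and> v \<in> V \<and> lab u = a \<and> lab v = b}, lab) \<in> CW k"

inductive_set NLC :: "nat \<Rightarrow> 'a labeled_graph set" for k :: nat where
  single: "lab v \<in> {1..k} \<Longrightarrow> ({v}, {}, lab) \<in> NLC k"
| join:
    "\<lbrakk>(V, E, lab) \<in> NLC k; (V', E', lab') \<in> NLC k; V \<inter> V' = {}; S \<subseteq> {1..k} \<times> {1..k}\<rbrakk>
     \<Longrightarrow> (V \<union> V',
          E \<union> E' \<union> {{u, v} | u v. u \<in> V \<and> v \<in> V' \<and> (lab u, lab' v) \<in> S},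
          \<lambda>v. if v \<in> V then lab v else lab' v) \<in> NLC k"
| relabel:
    "\<lbrakk>(V, E, lab) \<in> NLC k; R \<in> {1..k} \<rightarrow> {1..k}\<rbrakk> \<Longrightarrow> (V, E, \<lambda>v. R (lab v)) \<in> NLC k"

text \<open>
  The minima below are attained for every finite simple graph with at least one vertex
  (give every vertex its own label); for other \<open>(V, E)\<close> the value is unspecified.
\<close>

definition cw :: "'a set \<Rightarrow> 'a set set \<Rightarrow> nat" where
  "cw V E = (LEAST k. 0 < k \<and> (\<exists>lab. (V, E, lab) \<in> CW k))"

definition nlcw :: "'a set \<Rightarrow> 'a set set \<Rightarrow> nat" where
  "nlcw V E = (LEAST k. 0 < k \<and> (\<exists>lab. (V, E, lab) \<in> NLC k))"

end

(*
  Given a k-expression, reserve two new labels for x and y and keep every other label. As x and y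
  are then told apart from all other vertices, each operation can be carried out on any induced
  subgraph exactly as before, except that the pair {x, y} is treated at will. Hence, from an
  expression for one of the two graphs, k + 2 labels suffice for the other: either drop z and
  insert the edge {x, y}, or drop the edge {x, y} and attach z to the two reserved labels.
*)
theory Submission
  imports Defs
begin

section \<open>Reserving labels for two vertices\<close>

text \<open>The reserved labels sit just above the old range \<open>{1..k}\<close>, so no other
  vertex carries them and no old relabeling produces them, and \<open>k + 2\<close> labels suffice
  in all.\<close>

definition pin :: "nat \<Rightarrow> 'a \<Rightarrow> 'a \<Rightarrow> ('a \<Rightarrow> nat) \<Rightarrow> 'a \<Rightarrow> nat" where
  "pin k x y lab = lab(x := k + 1, y := k + 2)"

text \<open>A reserved label belongs to one vertex only, so a coincidence of new labels is either
  trivial or a coincidence of old labels. Hence every condition on old labels and on membership in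
  \<open>{x, y}\<close> can be read off the new labels.\<close>

lemma pin_eqD:
  assumes "pin k x y lab u = pin k x y lab v" "x \<noteq> y" "lab u \<in> {1..k}" "lab v \<in> {1..k}"
  shows "u = v \<or> u \<notin> {x, y} \<and> v \<notin> {x, y} \<and> lab u = lab v"
  using assms by (auto simp: pin_def split: if_splits)

lemma pin_eq_Suc_iff:
  "lab v \<in> {1..k} \<Longrightarrow> x \<noteq> y \<Longrightarrow> pin k x y lab v = k + 1 \<longleftrightarrow> v = x"
  by (auto simp: pin_def)

lemma pin_eq_add_2_iff: "lab v \<in> {1..k} \<Longrightarrow> pin k x y lab v = k + 2 \<longleftrightarrow> v = y"
  by (auto simp: pin_def)

lemma pin_range: "lab v \<in> {1..k} \<Longrightarrow> pin k x y lab v \<in> {1..k + 2}"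
  by (auto simp: pin_def)

section \<open>Label ranges and edges of constructible graphs\<close>

lemma CW_wf:
  assumes "(V, E, lab) \<in> CW k"
  shows "(\<forall>v\<in>V. lab v \<in> {1..k}) \<and> (\<forall>e\<in>E. e \<subseteq> V \<and> e \<noteq> {})"
  using assms by (induction rule: CW.induct[split_format (complete)]) auto

lemma NLC_wf:
  assumes "(V, E, lab) \<in> NLC k"
  shows "(\<forall>v\<in>V. lab v \<in> {1..k}) \<and> (\<forall>e\<in>E. e \<subseteq> V \<and> e \<noteq> {})"
  using assms
proof (induction rule: NLC.induct[split_format (complete)])
  case (relabel V E lab R)
  then have "\<forall>v\<in>V. R (lab v) \<in> {1..k}" by (blast dest: funcset_mem)
  with relabel show ?case by blast
qed auto

text \<open>The rule \<open>add_edges\<close> requires two distinct labels, and only one is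
  available. It follows that any graph with an edge has \<open>k \<ge> 2\<close>.\<close>

lemma CW_one_no_edges: "(V, E, lab) \<in> CW (Suc 0) \<Longrightarrow> E = {}"
  by (induction rule: CW.induct[split_format (complete)]) auto

text \<open>The rule \<open>add_edges\<close> leaves all labels as they are, so it can be applied to
  the pairs in \<open>T\<close> one after another without interference.\<close>

lemma CW_add_edge_set:
  assumes "finite T" "(V, E, lab) \<in> CW k" "T \<subseteq> {1..k} \<times> {1..k}" "\<And>a b. (a, b) \<in> T \<Longrightarrow> a \<noteq> b"
  shows "(V, E \<union> {{u, v} | u v. u \<in> V \<and> v \<in> V \<and> (lab u, lab v) \<in> T}, lab) \<in> CW k"
  using assms
proof (induction T)
  case empty
  then show ?case by simp
next
  case (insert p T)
  obtain a b where p: "p = (a, b)" by fastforce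
  let ?X = "\<lambda>T. {{u, v} | u v. u \<in> V \<and> v \<in> V \<and> (lab u, lab v) \<in> T}"
  have 1: "(V, E \<union> ?X T, lab) \<in> CW k"
    using insert by blast
  have "(V, (E \<union> ?X T) \<union> {{u, v} | u v. u \<in> V \<and> v \<in> V \<and> lab u = a \<and> lab v = b}, lab) \<in> CW k"
    using insert.prems(2) insert.prems(3)[of a b] p by (intro CW.add_edges[OF 1]) blast+
  moreover have "(E \<union> ?X T) \<union> {{u, v} | u v. u \<in> V \<and> v \<in> V \<and> lab u = a \<and> lab v = b}
      = E \<union> ?X (insert p T)"
    unfolding p by blast
  ultimately show ?case by metis
qed

text \<open>Induction on the expression, for all \<open>W\<close> at once because a disjoint union
  splits \<open>W\<close> between its operands. The edge \<open>{x, y}\<close> is always left out: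
  the reserved labels allow it to be added at the very end. Labels are compared on \<open>W\<close>
  only, as values elsewhere are arbitrary.\<close>

lemma CW_pin:
  assumes "(V, E, lab) \<in> CW k" "x \<noteq> y" "W \<subseteq> V" "W \<noteq> {}"
  obtains l where "(W, {e \<in> E. e \<subseteq> W \<and> e \<noteq> {x, y}}, l) \<in> CW (k + 2)"
    "\<forall>v\<in>W. l v = pin k x y lab v"
proof -
  have "\<exists>l. (W, {e \<in> E. e \<subseteq> W \<and> e \<noteq> {x, y}}, l) \<in> CW (k + 2) \<and>
      (\<forall>v\<in>W. l v = pin k x y lab v)"
    using assms
  proof (induction arbitrary: W rule: CW.induct[split_format (complete)])
    case (single lab v)
    then have "W = {v}" by auto
    then show ?case
      using CW.single[of "pin k x y lab" v "k + 2"] pin_range[of lab v k] single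
      by (intro exI[of _ "pin k x y lab"]) auto
  next
    case (disjoint_union V E lab V' E' lab')
    note wf = CW_wf[OF disjoint_union.hyps(1)] CW_wf[OF disjoint_union.hyps(2)]
    let ?L = "\<lambda>v. if v \<in> V then lab v else lab' v"
    let ?F = "\<lambda>E W. {e \<in> E. e \<subseteq> W \<and> e \<noteq> {x, y}}"
    have F: "?F (E \<union> E') W = ?F E (W \<inter> V) \<union> ?F E' (W \<inter> V')"
      using wf by auto
    have W: "W = (W \<inter> V) \<union> (W \<inter> V')"
      using disjoint_union.prems by blast
    \<comment> \<open>No rule yields the empty graph. If \<open>W\<close> misses one operand, that
      operand is dropped together with the union.\<close>
    consider "W \<inter> V = {}" | "W \<inter> V' = {}" | "W \<inter> V \<noteq> {}" "W \<inter> V' \<noteq> {}" by blast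
    then show ?case
    proof cases
      case 1
      then have "W \<inter> V' = W" using W by blast
      then obtain l where l: "(W, ?F E' W, l) \<in> CW (k + 2)" "\<forall>v\<in>W. l v = pin k x y lab' v"
        using disjoint_union.IH(2)[of W] disjoint_union.prems by auto
      \<comment> \<open>Each edge of \<open>E\<close> is a nonempty subset of \<open>V\<close>,
        hence meets \<open>V\<close>, while \<open>W\<close> does not.\<close>
      have "e \<inter> V \<noteq> {}" if "e \<in> E" for e
        using wf(1) that by (auto simp: Int_absorb2)
      then have "\<not> e \<subseteq> W" if "e \<in> E" for e
        using that 1 by blast
      then have "?F (E \<union> E') W = ?F E' W"
        by blast
      moreover have "\<forall>v\<in>W. l v = pin k x y ?L v"
        using l(2) 1 by (auto simp: pin_def)
      ultimately show ?thesis
        using l(1) by (intro exI[of _ l]) (simp only:)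
    next
      case 2
      then have "W \<inter> V = W" using W by blast
      then obtain l where l: "(W, ?F E W, l) \<in> CW (k + 2)" "\<forall>v\<in>W. l v = pin k x y lab v"
        using disjoint_union.IH(1)[of W] disjoint_union.prems by auto
      have "e \<inter> V' \<noteq> {}" if "e \<in> E'" for e
        using wf(2) that by (auto simp: Int_absorb2)
      then have "\<not> e \<subseteq> W" if "e \<in> E'" for e
        using that 2 by blast
      then have "?F (E \<union> E') W = ?F E W"
        by blast
      moreover have "\<forall>v\<in>W. l v = pin k x y ?L v"
        using l(2) \<open>W \<inter> V = W\<close> by (auto simp: pin_def)
      ultimately show ?thesis
        using l(1) by (intro exI[of _ l]) (simp only:)
    next
      case 3
      obtain l1 where l1: "(W \<inter> V, ?F E (W \<inter> V), l1) \<in> CW (k + 2)"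
        "\<forall>v\<in>W \<inter> V. l1 v = pin k x y lab v"
        using disjoint_union.IH(1)[of "W \<inter> V"] disjoint_union.prems 3 by auto
      obtain l2 where l2: "(W \<inter> V', ?F E' (W \<inter> V'), l2) \<in> CW (k + 2)"
        "\<forall>v\<in>W \<inter> V'. l2 v = pin k x y lab' v"
        using disjoint_union.IH(2)[of "W \<inter> V'"] disjoint_union.prems 3 by auto
      let ?l = "\<lambda>v. if v \<in> W \<inter> V then l1 v else l2 v"
      have "(W, ?F (E \<union> E') W, ?l) \<in> CW (k + 2)"
      proof -
        have "(W \<inter> V) \<inter> (W \<inter> V') = {}"
          using disjoint_union.hyps by blast
        from CW.disjoint_union[OF l1(1) l2(1) this] show ?thesis
          by (simp only: F flip: W)
      qed
      moreover have "\<forall>v\<in>W. ?l v = pin k x y ?L v"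
        using l1(2) l2(2) disjoint_union.prems(2) by (auto simp: pin_def)
      ultimately show ?thesis by (intro exI conjI)
    qed
  next
    case (relabel V E lab a b)
    from relabel.IH[OF relabel.prems]
    obtain l where l: "(W, {e \<in> E. e \<subseteq> W \<and> e \<noteq> {x, y}}, l) \<in> CW (k + 2)"
      "\<forall>v\<in>W. l v = pin k x y lab v"
      by blast
    \<comment> \<open>Since \<open>a \<le> k\<close>, the same relabeling leaves both reserved
      labels fixed.\<close>
    have "(W, {e \<in> E. e \<subseteq> W \<and> e \<noteq> {x, y}}, \<lambda>v. if l v = a then b else l v) \<in> CW (k + 2)"
      using relabel.hyps by (intro CW.relabel[OF l(1)]) auto
    moreover have "\<forall>v\<in>W. (if l v = a then b else l v) = pin k x y (\<lambda>v. if lab v = a then b else lab v) v"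
      using l(2) relabel.hyps by (auto simp: pin_def)
    ultimately show ?case by blast
  next
    case (add_edges V E lab a b)
    let ?F = "\<lambda>E. {e \<in> E. e \<subseteq> W \<and> e \<noteq> {x, y}}"
    let ?X = "{{u, v} | u v. u \<in> V \<and> v \<in> V \<and> lab u = a \<and> lab v = b}"
    from add_edges.IH[OF add_edges.prems]
    obtain l where l: "(W, ?F E, l) \<in> CW (k + 2)" "\<forall>v\<in>W. l v = pin k x y lab v"
      by blast
    have lab: "lab v \<in> {1..k}" if "v \<in> W" for v
      using CW_wf[OF add_edges.hyps(1)] add_edges.prems that by blast
    have inj: "u = v \<or> u \<notin> {x, y} \<and> v \<notin> {x, y} \<and> lab u = lab v"
      if "l u = l v" "u \<in> W" "v \<in> W" for u v
      using that l(2) lab add_edges.prems(1) pin_eqD by metis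
    \<comment> \<open>Pinned vertices no longer carry \<open>a\<close> or \<open>b\<close>, so a
      single edge insertion becomes a family of label pairs: the new labels of all vertex pairs
      formerly joined, with the pair \<open>{x, y}\<close> omitted.\<close>
    define T where "T = {(l u, l v) | u v. u \<in> W \<and> v \<in> W \<and> lab u = a \<and> lab v = b \<and> {u, v} \<noteq> {x, y}}"
    \<comment> \<open>Membership in \<open>T\<close> does not depend on the representing vertices:
      by \<open>inj\<close>, other representatives are the same vertices or unpinned ones with the
      same old labels.\<close>
    have T_iff: "(l u, l v) \<in> T \<longleftrightarrow> lab u = a \<and> lab v = b \<and> {u, v} \<noteq> {x, y}"
      if uv: "u \<in> W" "v \<in> W" for u v
    proof
      assume "(l u, l v) \<in> T"
      then obtain u' v' where *: "l u = l u'" "l v = l v'" "u' \<in> W" "v' \<in> W"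
          "lab u' = a" "lab v' = b" "{u', v'} \<noteq> {x, y}"
        by (auto simp: T_def)
      then show "lab u = a \<and> lab v = b \<and> {u, v} \<noteq> {x, y}"
        using inj[OF *(1) uv(1) *(3)] inj[OF *(2) uv(2) *(4)] by blast
    qed (use uv in \<open>auto simp: T_def\<close>)
    have T_sub: "T \<subseteq> {1..k + 2} \<times> {1..k + 2}"
      using CW_wf[OF l(1)] unfolding T_def by blast
    \<comment> \<open>Equal new labels would force equal old labels, against
      \<open>a \<noteq> b\<close>.\<close>
    have "p \<noteq> q" if "(p, q) \<in> T" for p q
      using that inj add_edges.hyps by (fastforce simp: T_def)
    then have "(W, ?F E \<union> {{u, v} | u v. u \<in> W \<and> v \<in> W \<and> (l u, l v) \<in> T}, l) \<in> CW (k + 2)"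
      using T_sub by (intro CW_add_edge_set l finite_subset[OF T_sub]) auto
    moreover have "?F E \<union> {{u, v} | u v. u \<in> W \<and> v \<in> W \<and> (l u, l v) \<in> T} = ?F (E \<union> ?X)"
    proof -
      have "{{u, v} | u v. u \<in> W \<and> v \<in> W \<and> (l u, l v) \<in> T} =
          {{u, v} | u v. u \<in> W \<and> v \<in> W \<and> lab u = a \<and> lab v = b \<and> {u, v} \<noteq> {x, y}}"
        by (simp add: T_iff cong: conj_cong)
      also have "\<dots> = ?F ?X"
      proof (intro subset_antisym subsetI)
        fix e assume "e \<in> ?F ?X"
        then obtain u v where "e = {u, v}" "lab u = a" "lab v = b" "{u, v} \<subseteq> W" "{u, v} \<noteq> {x, y}"
          by blast
        then show "e \<in> {{u, v} | u v. u \<in> W \<and> v \<in> W \<and> lab u = a \<and> lab v = b \<and> {u, v} \<noteq> {x, y}}"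
          by blast
      qed (use add_edges.prems(2) in blast)
      finally show ?thesis
        by (simp only: Un_iff conj_disj_distribR Collect_disj_eq)
    qed
    ultimately show ?case
      using l(2) by (intro exI[of _ l]) (simp only:)
  qed
  then show ?thesis
    using that by blast
qed

text \<open>
  A join can only link vertices from different operands, so an edge between \<open>x\<close> and \<open>y\<close> cannot
  be inserted into a finished graph: \<open>D\<close> fixes in advance whether it is to be created.
\<close>

lemma NLC_pin:
  assumes "(V, E, lab) \<in> NLC k" "x \<noteq> y" "D \<subseteq> {{x, y}}" "W \<subseteq> V" "W \<noteq> {}"
  obtains l where "(W, {e \<in> (E - {{x, y}}) \<union> D. e \<subseteq> W}, l) \<in> NLC (k + 2)"
    "\<forall>v\<in>W. l v = pin k x y lab v"
proof -
  have "\<exists>l. (W, {e \<in> (E - {{x, y}}) \<union> D. e \<subseteq> W}, l) \<in> NLC (k + 2) \<and>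
      (\<forall>v\<in>W. l v = pin k x y lab v)"
    using assms
  proof (induction arbitrary: W rule: NLC.induct[split_format (complete)])
    case (single lab v)
    then have "W = {v}" by auto
    \<comment> \<open>As \<open>x \<noteq> y\<close>, the edge that \<open>D\<close> may contain
      does not fit into a single vertex.\<close>
    moreover have "{e \<in> ({} - {{x, y}}) \<union> D. e \<subseteq> {v}} = {}"
      using single.prems by auto
    moreover have "({v}, {}, pin k x y lab) \<in> NLC (k + 2)"
      by (intro NLC.single pin_range single.hyps)
    ultimately show ?case
      by (intro exI[of _ "pin k x y lab"]) (simp only: simp_thms ball_simps)
  next
    case (join V E lab V' E' lab' S)
    note wf = NLC_wf[OF join.hyps(1)] NLC_wf[OF join.hyps(2)]
    let ?L = "\<lambda>v. if v \<in> V then lab v else lab' v"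
    let ?F = "\<lambda>E W. {e \<in> (E - {{x, y}}) \<union> D. e \<subseteq> W}"
    let ?X = "{{u, v} | u v. u \<in> V \<and> v \<in> V' \<and> (lab u, lab' v) \<in> S}"
    have W: "W = (W \<inter> V) \<union> (W \<inter> V')"
      using join.prems by blast
    consider "W \<inter> V = {}" | "W \<inter> V' = {}" | "W \<inter> V \<noteq> {}" "W \<inter> V' \<noteq> {}" by blast
    then show ?case
    proof cases
      case 1
      then have "W \<inter> V' = W" using W by blast
      then obtain l where l: "(W, ?F E' W, l) \<in> NLC (k + 2)" "\<forall>v\<in>W. l v = pin k x y lab' v"
        using join.IH(2)[of W] join.prems by auto
      have "e \<inter> V \<noteq> {}" if "e \<in> E \<union> ?X" for e
        using wf(1) that by auto
      then have "\<not> e \<subseteq> W" if "e \<in> E \<union> ?X" for e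
        using that 1 by blast
      then have "?F (E \<union> E' \<union> ?X) W = ?F E' W"
        by blast
      moreover have "\<forall>v\<in>W. l v = pin k x y ?L v"
        using l(2) 1 by (auto simp: pin_def)
      ultimately show ?thesis
        using l(1) by (intro exI[of _ l]) (simp only:)
    next
      case 2
      then have "W \<inter> V = W" using W by blast
      then obtain l where l: "(W, ?F E W, l) \<in> NLC (k + 2)" "\<forall>v\<in>W. l v = pin k x y lab v"
        using join.IH(1)[of W] join.prems by auto
      have "e \<inter> V' \<noteq> {}" if "e \<in> E' \<union> ?X" for e
        using wf(2) that by auto
      then have "\<not> e \<subseteq> W" if "e \<in> E' \<union> ?X" for e
        using that 2 by blast
      then have "?F (E \<union> E' \<union> ?X) W = ?F E W"
        by blast
      moreover have "\<forall>v\<in>W. l v = pin k x y ?L v"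
        using l(2) \<open>W \<inter> V = W\<close> by (auto simp: pin_def)
      ultimately show ?thesis
        using l(1) by (intro exI[of _ l]) (simp only:)
    next
      case 3
      let ?A = "W \<inter> V" and ?B = "W \<inter> V'"
      obtain l1 where l1: "(?A, ?F E ?A, l1) \<in> NLC (k + 2)" "\<forall>v\<in>?A. l1 v = pin k x y lab v"
        using join.IH(1)[of ?A] join.prems 3 by auto
      obtain l2 where l2: "(?B, ?F E' ?B, l2) \<in> NLC (k + 2)" "\<forall>v\<in>?B. l2 v = pin k x y lab' v"
        using join.IH(2)[of ?B] join.prems 3 by auto
      \<comment> \<open>For \<open>x\<close> and \<open>y\<close> on opposite sides,
        \<open>D\<close> alone decides whether they are joined; every other pair follows
        \<open>S\<close>.\<close>
      define P where "P u v \<longleftrightarrow> (if {u, v} = {x, y} then {x, y} \<in> D else (lab u, lab' v) \<in> S)" for u v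
      define S' where "S' = {(l1 u, l2 v) | u v. u \<in> ?A \<and> v \<in> ?B \<and> P u v}"
      have inj1: "u = v \<or> u \<notin> {x, y} \<and> v \<notin> {x, y} \<and> lab u = lab v"
        if "l1 u = l1 v" "u \<in> ?A" "v \<in> ?A" for u v
        using that l1(2) wf(1) join.prems(1) pin_eqD[of k x y lab u v] by auto
      have inj2: "u = v \<or> u \<notin> {x, y} \<and> v \<notin> {x, y} \<and> lab' u = lab' v"
        if "l2 u = l2 v" "u \<in> ?B" "v \<in> ?B" for u v
        using that l2(2) wf(2) join.prems(1) pin_eqD[of k x y lab' u v] by auto
      \<comment> \<open>Again the choice of representatives is immaterial: equal new labels mean the
        same vertex, or two unpinned vertices with the same old label.\<close>
      have S'_iff: "(l1 u, l2 v) \<in> S' \<longleftrightarrow> P u v" if uv: "u \<in> ?A" "v \<in> ?B" for u v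
      proof
        assume "(l1 u, l2 v) \<in> S'"
        then obtain u' v' where *: "l1 u = l1 u'" "l2 v = l2 v'" "u' \<in> ?A" "v' \<in> ?B" "P u' v'"
          by (auto simp: S'_def)
        have "({u, v} = {x, y}) = ({u', v'} = {x, y})" "{u, v} \<noteq> {x, y} \<Longrightarrow> lab u = lab u' \<and> lab' v = lab' v'"
          using inj1[OF *(1) uv(1) *(3)] inj2[OF *(2) uv(2) *(4)] by blast+
        then show "P u v"
          using *(5) unfolding P_def by metis
      qed (use uv in \<open>auto simp: S'_def\<close>)
      let ?l = "\<lambda>v. if v \<in> ?A then l1 v else l2 v"
      let ?Y = "{{u, v} | u v. u \<in> ?A \<and> v \<in> ?B \<and> (l1 u, l2 v) \<in> S'}"
      have "S' \<subseteq> {1..k + 2} \<times> {1..k + 2}"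
        using NLC_wf[OF l1(1)] NLC_wf[OF l2(1)] unfolding S'_def by blast
      moreover have "?A \<inter> ?B = {}"
        using join.hyps by blast
      ultimately have "(?A \<union> ?B, ?F E ?A \<union> ?F E' ?B \<union> ?Y, ?l) \<in> NLC (k + 2)"
        by (intro NLC.join[OF l1(1) l2(1)])
      moreover have "?F E ?A \<union> ?F E' ?B \<union> ?Y = ?F (E \<union> E' \<union> ?X) W"
      proof -
        have Y: "?Y = {{u, v} | u v. u \<in> ?A \<and> v \<in> ?B \<and> P u v}"
          using S'_iff by blast
        have sub1: "{{u, v} | u v. u \<in> ?A \<and> v \<in> ?B \<and> P u v} \<subseteq> ?F (E \<union> E' \<union> ?X) W"
        proof clarify
          fix u v assume uv: "u \<in> W" "u \<in> V" "v \<in> W" "v \<in> V'" "P u v"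
          show "{u, v} \<in> (E \<union> E' \<union> ?X - {{x, y}}) \<union> D \<and> {u, v} \<subseteq> W"
          proof (cases "{u, v} = {x, y}")
            case True
            then show ?thesis using uv unfolding P_def by auto
          next
            case False
            then show ?thesis using uv unfolding P_def by auto
          qed
        qed
        have sub2: "?F E ?A \<union> ?F E' ?B \<subseteq> ?F (E \<union> E' \<union> ?X) W"
          by blast
        have sub3: "e \<in> ?F E ?A \<union> ?F E' ?B \<union> {{u, v} | u v. u \<in> ?A \<and> v \<in> ?B \<and> P u v}"
          if e: "e \<in> ?F (E \<union> E' \<union> ?X) W" for e
        proof -
          consider "e \<in> E" "e \<noteq> {x, y}" | "e \<in> E'" "e \<noteq> {x, y}" | "e \<in> ?X" "e \<noteq> {x, y}" | "e \<in> D"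
            using e by blast
          then show ?thesis
          proof cases
            case 1
            then have "e \<in> ?F E ?A" using wf(1) e by auto
            then show ?thesis by (rule UnI1[THEN UnI1])
          next
            case 2
            then have "e \<in> ?F E' ?B" using wf(2) e by auto
            then show ?thesis by (rule UnI2[THEN UnI1])
          next
            case 3
            then obtain u v where "e = {u, v}" "u \<in> V" "v \<in> V'" "(lab u, lab' v) \<in> S" by blast
            then have "u \<in> ?A" "v \<in> ?B" "P u v" "e = {u, v}"
              using e 3 by (auto simp: P_def)
            then show ?thesis by blast
          next
            case 4
            then have "e = {x, y}" "{x, y} \<in> D" using join.prems(2) by auto
            \<comment> \<open>Either of \<open>x\<close> and \<open>y\<close> may lie in the left
              operand, so both orientations are recorded. If both lie in the same operand, its
              induction hypothesis already supplies the edge.\<close>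
            then have P: "P x y" "P y x" by (simp_all add: P_def insert_commute)
            have "x \<in> W" "y \<in> W" using e \<open>e = {x, y}\<close> by auto
            then consider "e \<subseteq> ?A" | "e \<subseteq> ?B" | u v where "u \<in> ?A" "v \<in> ?B" "P u v" "e = {u, v}"
              using W P \<open>e = {x, y}\<close> insert_commute[of x y "{}"] by (metis UnE empty_subsetI insert_subset)
            then show ?thesis
              using 4 by cases blast+
          qed
        qed
        show ?thesis
          unfolding Y by (rule subset_antisym[OF Un_least[OF sub2 sub1] subsetI[OF sub3]])
      qed
      ultimately have "(W, ?F (E \<union> E' \<union> ?X) W, ?l) \<in> NLC (k + 2)"
        using W by metis
      moreover have "\<forall>v\<in>W. ?l v = pin k x y ?L v"
        using l1(2) l2(2) join.prems(3) by (auto simp: pin_def)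
      ultimately show ?thesis by (intro exI conjI)
    qed
  next
    case (relabel V E lab R)
    let ?F = "{e \<in> (E - {{x, y}}) \<union> D. e \<subseteq> W}"
    from relabel.IH[OF relabel.prems]
    obtain l where l: "(W, ?F, l) \<in> NLC (k + 2)" "\<forall>v\<in>W. l v = pin k x y lab v"
      by blast
    \<comment> \<open>The map \<open>R\<close> is constrained on \<open>{1..k}\<close> only; it is
      replaced by the identity above \<open>k\<close> to preserve the reserved labels.\<close>
    let ?R = "\<lambda>p. if p \<le> k then R p else p"
    have "R p \<in> {1..k}" if "1 \<le> p" "p \<le> k" for p
      using relabel.hyps that by (auto dest: funcset_mem)
    then have "?R \<in> {1..k + 2} \<rightarrow> {1..k + 2}"
      by fastforce
    then have "(W, ?F, \<lambda>v. ?R (l v)) \<in> NLC (k + 2)"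
      by (rule NLC.relabel[OF l(1)])
    moreover have "\<forall>v\<in>W. ?R (l v) = pin k x y (\<lambda>v. R (lab v)) v"
      using l(2) NLC_wf[OF relabel.hyps(1)] relabel.prems by (auto simp: pin_def)
    ultimately show ?case by blast
  qed
  then show ?thesis
    using that by blast
qed

section \<open>The minima are attained\<close>

lemma finite_inj_on_atLeastAtMost:
  assumes "finite V"
  obtains f :: "'a \<Rightarrow> nat" and n where "inj_on f V" "f ` V \<subseteq> {1..n}"
proof -
  obtain g :: "'a \<Rightarrow> nat" and n where g: "g ` V = {i. i < n}" "inj_on g V"
    using finite_imp_inj_to_nat_seg[OF assms] by auto
  have "g v < n" if "v \<in> V" for v
    using g(1) that by blast
  \<comment> \<open>Labels start at 1, hence the shift by \<open>Suc\<close>.\<close>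
  then have "inj_on (\<lambda>v. Suc (g v)) V" "(\<lambda>v. Suc (g v)) ` V \<subseteq> {1..n}"
    using g(2) by (auto simp: inj_on_def Suc_le_eq)
  then show thesis by (rule that)
qed

text \<open>With pairwise distinct labels, a label pair determines a vertex pair. All vertices are
  united first, and then the edges are inserted as a set of label pairs.\<close>

lemma ex_CW:
  assumes G: "finite_simple_graph V E" and "V \<noteq> {}"
  obtains k lab where "0 < k" "(V, E, lab) \<in> CW k"
proof -
  have fin: "finite V" using G by (simp add: finite_simple_graph_def)
  then obtain f :: "'a \<Rightarrow> nat" and n where f: "inj_on f V" "f ` V \<subseteq> {1..n}"
    by (rule finite_inj_on_atLeastAtMost)
  have "(W, {}, f) \<in> CW n" if "finite W" "W \<noteq> {}" "W \<subseteq> V" for W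
    using that
  proof (induction rule: finite_ne_induct)
    case (singleton v)
    then show ?case using f by (intro CW.single) auto
  next
    case (insert v W)
    have "({v} \<union> W, {} \<union> {}, \<lambda>u. if u \<in> {v} then f u else f u) \<in> CW n"
      using insert f by (intro CW.disjoint_union CW.single) auto
    then show ?case by simp
  qed
  then have V: "(V, {}, f) \<in> CW n"
    using fin assms by blast
  define T where "T = {(f u, f v) | u v. u \<in> V \<and> v \<in> V \<and> u \<noteq> v \<and> {u, v} \<in> E}"
  have T_sub: "T \<subseteq> {1..n} \<times> {1..n}"
    using f(2) by (auto simp: T_def)
  have "p \<noteq> q" if "(p, q) \<in> T" for p q
    using that f(1) by (auto simp: T_def inj_on_def)
  then have "(V, {} \<union> {{u, v} | u v. u \<in> V \<and> v \<in> V \<and> (f u, f v) \<in> T}, f) \<in> CW n"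
    using T_sub by (intro CW_add_edge_set V finite_subset[OF T_sub]) auto
  moreover have "{} \<union> {{u, v} | u v. u \<in> V \<and> v \<in> V \<and> (f u, f v) \<in> T} = E"
  proof -
    have "(f u, f v) \<in> T \<longleftrightarrow> u \<noteq> v \<and> {u, v} \<in> E" if "u \<in> V" "v \<in> V" for u v
      using that f(1) unfolding T_def inj_on_def by blast
    then have "{{u, v} | u v. u \<in> V \<and> v \<in> V \<and> (f u, f v) \<in> T} =
        {{u, v} | u v. u \<in> V \<and> v \<in> V \<and> u \<noteq> v \<and> {u, v} \<in> E}"
      by blast
    moreover have "\<dots> \<subseteq> E"
      by blast
    moreover have "E \<subseteq> {{u, v} | u v. u \<in> V \<and> v \<in> V \<and> u \<noteq> v \<and> {u, v} \<in> E}"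
    proof
      fix e assume e: "e \<in> E"
      then obtain u v where "u \<in> V" "v \<in> V" "u \<noteq> v" "e = {u, v}"
        using G unfolding finite_simple_graph_def by metis
      then show "e \<in> {{u, v} | u v. u \<in> V \<and> v \<in> V \<and> u \<noteq> v \<and> {u, v} \<in> E}"
        using e by blast
    qed
    ultimately show ?thesis by (simp only: Un_empty_left subset_antisym)
  qed
  ultimately have "(V, E, f) \<in> CW n" by metis
  moreover have "n > 0" using f(2) assms(2) by (auto intro: ccontr)
  ultimately show ?thesis
    using that by blast
qed

text \<open>A join creates edges only between its operands, so edges must arise while the vertex set
  grows: each new vertex is joined to its neighbors among the vertices present, and the invariant is
  the induced subgraph on \<open>W\<close>.\<close>

lemma ex_NLC:
  assumes G: "finite_simple_graph V E" and "V \<noteq> {}"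
  obtains k lab where "0 < k" "(V, E, lab) \<in> NLC k"
proof -
  have fin: "finite V" using G by (simp add: finite_simple_graph_def)
  have E: "\<exists>u\<in>V. \<exists>v\<in>V. u \<noteq> v \<and> e = {u, v}" if "e \<in> E" for e
    using G that by (simp add: finite_simple_graph_def)
  from fin obtain f :: "'a \<Rightarrow> nat" and n where f: "inj_on f V" "f ` V \<subseteq> {1..n}"
    by (rule finite_inj_on_atLeastAtMost)
  have "(W, {e \<in> E. e \<subseteq> W}, f) \<in> NLC n" if "finite W" "W \<noteq> {}" "W \<subseteq> V" for W
    using that
  proof (induction rule: finite_ne_induct)
    case (singleton v)
    have "{e \<in> E. e \<subseteq> {v}} = {}" using E by fastforce
    moreover have "({v}, {}, f) \<in> NLC n"
      using singleton f by (intro NLC.single) auto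
    ultimately show ?case by (simp only:)
  next
    case (insert v W)
    define S where "S = {(f v, f u) | u. u \<in> W \<and> {v, u} \<in> E}"
    let ?X = "{{a, b} | a b. a \<in> {v} \<and> b \<in> W \<and> (f a, f b) \<in> S}"
    have "({v} \<union> W, {} \<union> {e \<in> E. e \<subseteq> W} \<union> ?X, \<lambda>u. if u \<in> {v} then f u else f u) \<in> NLC n"
      using insert f by (intro NLC.join NLC.single) (auto simp: S_def)
    moreover have "{} \<union> {e \<in> E. e \<subseteq> W} \<union> ?X = {e \<in> E. e \<subseteq> insert v W}"
    proof -
      have "(f v, f b) \<in> S \<longleftrightarrow> {v, b} \<in> E" if "b \<in> W" for b
        using that f(1) insert.prems unfolding S_def inj_on_def by blast
      then have X: "?X = {{v, b} | b. b \<in> W \<and> {v, b} \<in> E}"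
        by blast
      have "e \<in> {e \<in> E. e \<subseteq> W} \<union> {{v, b} | b. b \<in> W \<and> {v, b} \<in> E}"
        if e: "e \<in> E" "e \<subseteq> insert v W" for e
      proof -
        obtain a b where ab: "a \<noteq> b" "e = {a, b}" using E[OF e(1)] by blast
        then have "{a, b} \<subseteq> insert v W" "e = {b, a}"
          using e by (simp_all add: insert_commute)
        then consider "e \<subseteq> W" | b where "b \<in> W" "e = {v, b}"
          using ab by auto
        then show ?thesis
          using e by cases blast+
      qed
      then show ?thesis unfolding X by blast
    qed
    ultimately show ?case by simp
  qed
  then have "(V, {e \<in> E. e \<subseteq> V}, f) \<in> NLC n"
    using fin assms by blast
  moreover have "{e \<in> E. e \<subseteq> V} = E" using E by blast
  ultimately have "(V, E, f) \<in> NLC n" by simp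
  moreover have "n > 0" using f(2) assms(2) by (auto intro: ccontr)
  ultimately show ?thesis
    using that by blast
qed

text \<open>\<open>LEAST\<close> satisfies its predicate only once some witness is known;
  \<open>ex_CW\<close> provides one.\<close>

lemma cw_attained:
  assumes "finite_simple_graph V E" "V \<noteq> {}"
  obtains lab where "(V, E, lab) \<in> CW (cw V E)"
proof -
  obtain k lab where "0 < k" "(V, E, lab) \<in> CW k"
    by (rule ex_CW[OF assms])
  then have "\<exists>k. 0 < k \<and> (\<exists>lab. (V, E, lab) \<in> CW k)"
    by blast
  from LeastI_ex[OF this] show ?thesis
    unfolding cw_def[symmetric] using that by blast
qed

lemma nlcw_attained:
  assumes "finite_simple_graph V E" "V \<noteq> {}"
  obtains lab where "(V, E, lab) \<in> NLC (nlcw V E)"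
proof -
  obtain k lab where "0 < k" "(V, E, lab) \<in> NLC k"
    by (rule ex_NLC[OF assms])
  then have "\<exists>k. 0 < k \<and> (\<exists>lab. (V, E, lab) \<in> NLC k)"
    by blast
  from LeastI_ex[OF this] show ?thesis
    unfolding nlcw_def[symmetric] using that by blast
qed

lemma cw_le: "0 < k \<Longrightarrow> (V, E, lab) \<in> CW k \<Longrightarrow> cw V E \<le> k"
  unfolding cw_def by (rule Least_le) blast

lemma nlcw_le: "0 < k \<Longrightarrow> (V, E, lab) \<in> NLC k \<Longrightarrow> nlcw V E \<le> k"
  unfolding nlcw_def by (rule Least_le) blast

section \<open>Edge subdivision\<close>

lemma subdivided_edge_ends:
  assumes G: "finite_simple_graph V E" and xy_E: "{x, y} \<in> E" and z: "z \<notin> V"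
  shows "x \<in> V \<and> y \<in> V \<and> x \<noteq> y \<and> z \<noteq> x \<and> z \<noteq> y"
  using G xy_E z unfolding finite_simple_graph_def by (auto simp: doubleton_eq_iff)

lemma finite_simple_graph_edge_subset:
  "finite_simple_graph V E \<Longrightarrow> e \<in> E \<Longrightarrow> e \<subseteq> V"
  unfolding finite_simple_graph_def by fastforce

lemma finite_simple_graph_subdivide:
  assumes G: "finite_simple_graph V E" and xy_E: "{x, y} \<in> E" and z: "z \<notin> V"
  shows "finite_simple_graph (subdivide_verts V z) (subdivide_edges E x y z)"
  using G subdivided_edge_ends[OF assms]
  unfolding finite_simple_graph_def subdivide_verts_def subdivide_edges_def by blast

lemma finite_simple_graph_delete_edge:
  assumes "finite_simple_graph V E"
  shows "{e \<in> E. e \<subseteq> V \<and> e \<noteq> {x, y}} = E - {{x, y}}"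
  using finite_simple_graph_edge_subset[OF assms] by auto

text \<open>Both new edges contain \<open>z\<close>, which lies outside \<open>V\<close>, so
  restriction to \<open>V\<close> removes them.\<close>

lemma subdivide_restrict_edges:
  assumes G: "finite_simple_graph V E" and z: "z \<notin> V"
  shows "{e \<in> subdivide_edges E x y z. e \<subseteq> V \<and> e \<noteq> {x, y}} = E - {{x, y}}"
  using finite_simple_graph_edge_subset[OF G] z by (auto simp: subdivide_edges_def)

section \<open>Clique-width expressions under subdivision\<close>

lemma CW_subdivide:
  assumes G: "finite_simple_graph V E" and xy_E: "{x, y} \<in> E" and z: "z \<notin> V"
    and expr: "(V, E, lab) \<in> CW k"
  obtains l where "(subdivide_verts V z, subdivide_edges E x y z, l) \<in> CW (k + 2)"
proof -
  have xy: "x \<in> V" "y \<in> V" "x \<noteq> y" "z \<noteq> x" "z \<noteq> y"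
    using subdivided_edge_ends[OF G xy_E z] by simp_all
  \<comment> \<open>Labels 1 and 2 must both lie below the reserved ones; for \<open>k = 1\<close>,
    label 2 would be the one reserved for \<open>x\<close>.\<close>
  have "k \<noteq> 0"
    using CW_wf[OF expr] xy by auto
  moreover have "k \<noteq> Suc 0"
    using CW_one_no_edges expr xy_E by blast
  ultimately have k: "2 \<le> k" by simp
  obtain l where l: "(V, E - {{x, y}}, l) \<in> CW (k + 2)" "\<forall>v\<in>V. l v = pin k x y lab v"
    using CW_pin[OF expr xy(3) subset_refl] xy(1) finite_simple_graph_delete_edge[OF G] by auto
  \<comment> \<open>Since \<open>k \<ge> 2\<close>, merging label 2 into 1 frees a label for \<open>z\<close>.\<close>
  define l1 where "l1 v = (if l v = 2 then 1 else l v)" for v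
  have l1_2: "l1 v \<noteq> 2" for v by (simp add: l1_def)
  have l1_iff: "l1 v = k + 1 \<longleftrightarrow> v = x" "l1 v = k + 2 \<longleftrightarrow> v = y" if "v \<in> V" for v
    using pin_eq_Suc_iff[of lab v k x y] pin_eq_add_2_iff[of lab v k x y] that l(2)
      CW_wf[OF expr] xy(3) k by (auto simp: l1_def)
  let ?l = "\<lambda>v. if v \<in> V then l1 v else 2"
  have "(V, E - {{x, y}}, l1) \<in> CW (k + 2)"
    unfolding l1_def using k by (intro CW.relabel l) auto
  moreover have "({z}, {}, \<lambda>_. 2) \<in> CW (k + 2)"
    by (intro CW.single) auto
  ultimately have 1: "(V \<union> {z}, (E - {{x, y}}) \<union> {}, ?l) \<in> CW (k + 2)"
    using z by (intro CW.disjoint_union) auto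
  \<comment> \<open>Label 2 now belongs to \<open>z\<close> alone and the reserved labels to
    \<open>x\<close> and \<open>y\<close> alone, so these pairs create exactly the two new edges.
    Merging old labels did no harm, as no later step tells them apart.\<close>
  let ?T = "{(k + 1, 2), (k + 2, 2)}"
  have "(V \<union> {z}, ((E - {{x, y}}) \<union> {}) \<union>
      {{u, v} | u v. u \<in> V \<union> {z} \<and> v \<in> V \<union> {z} \<and> (?l u, ?l v) \<in> ?T}, ?l) \<in> CW (k + 2)"
    using k by (intro CW_add_edge_set 1) auto
  moreover have "(?l u, ?l v) \<in> ?T \<longleftrightarrow> u \<in> {x, y} \<and> v = z"
    if "u \<in> V \<union> {z}" "v \<in> V \<union> {z}" for u v
    using that l1_2 l1_iff z k xy by auto
  then have "{{u, v} | u v. u \<in> V \<union> {z} \<and> v \<in> V \<union> {z} \<and> (?l u, ?l v) \<in> ?T} =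
      {{u, v} | u v. u \<in> V \<union> {z} \<and> v \<in> V \<union> {z} \<and> u \<in> {x, y} \<and> v = z}"
    by blast
  moreover have "\<dots> = {{x, z}, {y, z}}"
    using xy by blast
  ultimately show ?thesis
    using that by (auto simp: subdivide_verts_def subdivide_edges_def)
qed

text \<open>Restriction to \<open>V\<close> discards \<open>z\<close>; one edge insertion between
  the two reserved labels then restores \<open>{x, y}\<close>.\<close>

lemma CW_unsubdivide:
  assumes G: "finite_simple_graph V E" and xy_E: "{x, y} \<in> E" and z: "z \<notin> V"
    and expr: "(subdivide_verts V z, subdivide_edges E x y z, lab) \<in> CW k"
  obtains l where "(V, E, l) \<in> CW (k + 2)"
proof -
  have xy: "x \<in> V" "y \<in> V" "x \<noteq> y" "z \<noteq> x" "z \<noteq> y"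
    using subdivided_edge_ends[OF G xy_E z] by simp_all
  obtain l where l: "(V, E - {{x, y}}, l) \<in> CW (k + 2)" "\<forall>v\<in>V. l v = pin k x y lab v"
    using CW_pin[OF expr xy(3), of V] xy(1) subdivide_restrict_edges[OF G z]
    by (auto simp: subdivide_verts_def)
  have "lab v \<in> {1..k}" if "v \<in> V" for v
    using CW_wf[OF expr] that by (auto simp: subdivide_verts_def)
  then have iff: "l v = k + 1 \<longleftrightarrow> v = x" "l v = k + 2 \<longleftrightarrow> v = y" if "v \<in> V" for v
    using pin_eq_Suc_iff[of lab v k x y] pin_eq_add_2_iff[of lab v k x y] that l(2) xy(3) by auto
  have "(V, (E - {{x, y}}) \<union> {{u, v} | u v. u \<in> V \<and> v \<in> V \<and> l u = k + 1 \<and> l v = k + 2}, l)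
      \<in> CW (k + 2)"
    by (intro CW.add_edges l) auto
  moreover have "{{u, v} | u v. u \<in> V \<and> v \<in> V \<and> l u = k + 1 \<and> l v = k + 2} = {{x, y}}"
  proof -
    have "{{u, v} | u v. u \<in> V \<and> v \<in> V \<and> l u = k + 1 \<and> l v = k + 2} =
        {{u, v} | u v. u \<in> V \<and> v \<in> V \<and> u = x \<and> v = y}"
      by (simp only: iff cong: conj_cong)
    also have "\<dots> = {{x, y}}"
      using xy by blast
    finally show ?thesis .
  qed
  ultimately show ?thesis
    using xy_E that by (auto simp: insert_absorb)
qed

section \<open>NLC-width expressions under subdivision\<close>

lemma NLC_subdivide:
  assumes G: "finite_simple_graph V E" and xy_E: "{x, y} \<in> E" and z: "z \<notin> V"
    and expr: "(V, E, lab) \<in> NLC k"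
  obtains l where "(subdivide_verts V z, subdivide_edges E x y z, l) \<in> NLC (k + 2)"
proof -
  have xy: "x \<in> V" "y \<in> V" "x \<noteq> y" "z \<noteq> x" "z \<noteq> y"
    using subdivided_edge_ends[OF G xy_E z] by simp_all
  note E_sub = finite_simple_graph_edge_subset[OF G]
  \<comment> \<open>The choice \<open>D = {}\<close> deletes the edge \<open>{x, y}\<close>.\<close>
  have "{e \<in> (E - {{x, y}}) \<union> {}. e \<subseteq> V} = E - {{x, y}}"
    using E_sub by blast
  then obtain l where l: "(V, E - {{x, y}}, l) \<in> NLC (k + 2)" "\<forall>v\<in>V. l v = pin k x y lab v"
    using NLC_pin[OF expr xy(3) empty_subsetI subset_refl] xy(1) by auto
  have iff: "l v \<in> {k + 1, k + 2} \<longleftrightarrow> v \<in> {x, y}" if "v \<in> V" for v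
    using pin_eq_Suc_iff[of lab v k x y] pin_eq_add_2_iff[of lab v k x y] that l(2)
      NLC_wf[OF expr] xy(3) by auto
  \<comment> \<open>A join links only across its operands, so \<open>z\<close> may share label 1
    with vertices of \<open>V\<close>.\<close>
  let ?S = "{k + 1, k + 2} \<times> {1 :: nat}"
  have 1: "({z}, {}, \<lambda>_. 1) \<in> NLC (k + 2)"
    by (intro NLC.single) auto
  have "(V \<union> {z}, (E - {{x, y}}) \<union> {} \<union> {{u, v} | u v. u \<in> V \<and> v \<in> {z} \<and> (l u, 1) \<in> ?S},
      \<lambda>v. if v \<in> V then l v else 1) \<in> NLC (k + 2)"
    using z by (intro NLC.join[OF l(1) 1]) auto
  moreover have "(l u, 1) \<in> ?S \<longleftrightarrow> u \<in> {x, y}" if "u \<in> V" for u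
    using iff[OF that] by blast
  then have "{{u, v} | u v. u \<in> V \<and> v \<in> {z} \<and> (l u, 1) \<in> ?S} =
      {{u, v} | u v. u \<in> V \<and> v \<in> {z} \<and> u \<in> {x, y}}"
    by blast
  moreover have "\<dots> = {{x, z}, {y, z}}"
    using xy by blast
  ultimately show ?thesis
    using that by (auto simp: subdivide_verts_def subdivide_edges_def)
qed

text \<open>With \<open>W = V\<close> and \<open>D = {{x, y}}\<close>, the vertex \<open>z\<close>
  disappears and the edge is created at the join that brings \<open>x\<close> and \<open>y\<close>
  together.\<close>

lemma NLC_unsubdivide:
  assumes G: "finite_simple_graph V E" and xy_E: "{x, y} \<in> E" and z: "z \<notin> V"
    and expr: "(subdivide_verts V z, subdivide_edges E x y z, lab) \<in> NLC k"
  obtains l where "(V, E, l) \<in> NLC (k + 2)"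
proof -
  have xy: "x \<in> V" "y \<in> V" "x \<noteq> y" "z \<noteq> x" "z \<noteq> y"
    using subdivided_edge_ends[OF G xy_E z] by simp_all
  note E_sub = finite_simple_graph_edge_subset[OF G]
  have edges: "{e \<in> (subdivide_edges E x y z - {{x, y}}) \<union> {{x, y}}. e \<subseteq> V} = E"
    using E_sub xy_E z unfolding subdivide_edges_def by blast
  have sub: "V \<subseteq> subdivide_verts V z" "V \<noteq> {}"
    using xy(1) by (auto simp: subdivide_verts_def)
  show ?thesis
    using NLC_pin[OF expr xy(3) subset_refl sub] that unfolding edges by blast
qed

section \<open>The four inequalities, from optimal expressions\<close>

theorem theorem9:
  fixes V :: "'a set" and E :: "'a set set" and x y z :: 'a
  assumes "finite_simple_graph V E"
    and "{x, y} \<in> E"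
    and "z \<notin> V"
  shows "(int (nlcw V E) - 2
            \<le> int (nlcw (subdivide_verts V z) (subdivide_edges E x y z)) \<and>
          int (nlcw (subdivide_verts V z) (subdivide_edges E x y z))
            \<le> int (nlcw V E) + 2) \<and>
         (int (cw V E) - 2
            \<le> int (cw (subdivide_verts V z) (subdivide_edges E x y z)) \<and>
          int (cw (subdivide_verts V z) (subdivide_edges E x y z))
            \<le> int (cw V E) + 2)"
proof -
  let ?V = "subdivide_verts V z" and ?E = "subdivide_edges E x y z"
  have ne: "V \<noteq> {}" "?V \<noteq> {}"
    using subdivided_edge_ends[OF assms] by (auto simp: subdivide_verts_def)
  \<comment> \<open>An optimal expression for either graph is turned into one for the other with two
    more labels; the direction back to \<open>V\<close>, \<open>E\<close> gives the lower
    bounds.\<close>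
  obtain lab1 where "(?V, ?E, lab1) \<in> NLC (nlcw ?V ?E)"
    by (rule nlcw_attained[OF finite_simple_graph_subdivide[OF assms] ne(2)])
  then obtain l1 where "(V, E, l1) \<in> NLC (nlcw ?V ?E + 2)"
    by (rule NLC_unsubdivide[OF assms])
  then have nlcw1: "nlcw V E \<le> nlcw ?V ?E + 2"
    by (rule nlcw_le[rotated]) simp
  obtain lab2 where "(V, E, lab2) \<in> NLC (nlcw V E)"
    by (rule nlcw_attained[OF assms(1) ne(1)])
  then obtain l2 where "(?V, ?E, l2) \<in> NLC (nlcw V E + 2)"
    by (rule NLC_subdivide[OF assms])
  then have nlcw2: "nlcw ?V ?E \<le> nlcw V E + 2"
    by (rule nlcw_le[rotated]) simp
  obtain lab3 where "(?V, ?E, lab3) \<in> CW (cw ?V ?E)"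
    by (rule cw_attained[OF finite_simple_graph_subdivide[OF assms] ne(2)])
  then obtain l3 where "(V, E, l3) \<in> CW (cw ?V ?E + 2)"
    by (rule CW_unsubdivide[OF assms])
  then have cw1: "cw V E \<le> cw ?V ?E + 2"
    by (rule cw_le[rotated]) simp
  obtain lab4 where "(V, E, lab4) \<in> CW (cw V E)"
    by (rule cw_attained[OF assms(1) ne(1)])
  then obtain l4 where "(?V, ?E, l4) \<in> CW (cw V E + 2)"
    by (rule CW_subdivide[OF assms])
  then have cw2: "cw ?V ?E \<le> cw V E + 2"
    by (rule cw_le[rotated]) simp
  from nlcw1 nlcw2 cw1 cw2 show ?thesis
    by simp
qed

end
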